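(* Let $i$ be a positive integer, let $D$ be an $\langle i,2\rangle$ digraph and let $G$ be its competition graph. Then $G$ is chordal if and only if $D$ has no subdigraph $D'$ which is a $\langle\bar 2,\bar 2\rangle$ digraph such that (i) $D'$ is irredundant, (ii) $D'$ does not induce a triangle, and (iii) $D'$ has at least one arc.
   Context: All digraphs are finite, without loops and without parallel arcs; all graphs are finite and simple. The competition graph of a digraph $D$ has vertex set $V(D)$ and an edge $uv$ ($u\ne v$) iff $u$ and $v$ have a common out-neighbor in $D$. For positive integers $i,j$, an $\langle i,j\rangle$ digraph is a loopless digraph in which every vertex has indegree at most $i$ and outdegree at most $j$ (not necessarily acyclic). A $\langle\bar 2,\bar 2\rangle$ digraph is a loopless digraph in which every vertex has indegree $0$ or $2$ and outdegree $0$ or $2$. A digraph is irredundant if it has no (not necessarily induced) subdigraph isomorphic to $P(2,2)$, the digraph on four distinct vertices $u,v,x,y$ with arcs $(u,x),(u,y),(v,x),(v,y)$. A digraph $D$ induces a triangle if it has a (not necessarily induced) subdigraph isomorphic to one of the following five digraphs: (a) vertices $u_1,u_2,u_3,v_1,v_2,v_3$ with arcs $(u_1,v_1),(u_1,v_3),(u_2,v_1),(u_2,v_2),(u_3,v_2),(u_3,v_3)$; (b) vertices $u_1,u_2,u_3,v_1$ with arcs $(u_1,v_1),(u_2,v_1),(u_3,v_1)$; (c) vertices $u_1,u_2,u_3,v_1,v_3$ with arcs $(u_1,v_1),(u_1,u_2),(u_2,v_1),(u_2,v_3),(u_3,u_2),(u_3,v_3)$; (d) vertices $u_1,u_2,u_3$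 with all six arcs $(u_a,u_b)$, $a\ne b$; (e) vertices $u_1,u_2,v_1,v_2$ with arcs $(u_1,u_2),(u_2,u_1),(u_1,v_1),(u_2,v_1),(v_2,u_1),(v_2,u_2)$. A graph is chordal if it has no induced cycle of length at least $4$. *)

theory Defs
  imports "Graph_Theory.Graph_Theory"
begin

text \<open>
  A finite digraph without loops and parallel arcs is the locale predicate \<open>digraph\<close> of
  Graph_Theory, and a (not necessarily induced) subdigraph is its \<open>subgraph\<close>. Following that
  library, a finite simple graph is a symmetric such digraph (locale \<open>graph\<close>): the edge
  \<open>uv\<close> is the pair of arcs \<open>(u,v)\<close> and \<open>(v,u)\<close>.
\<close>

definition competition_graph :: "('a,'b) pre_digraph \<Rightarrow> 'a pair_pre_digraph" where
  "competition_graph D =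
     \<lparr> pverts = verts D,
       parcs = {(u, v). u \<in> verts D \<and> v \<in> verts D \<and> u \<noteq> v \<and>
                        (\<exists>w\<in>verts D. u \<rightarrow>\<^bsub>D\<^esub> w \<and> v \<rightarrow>\<^bsub>D\<^esub> w)} \<rparr>"

lemma graph_competition_graph:
  assumes "digraph D"
  shows "graph (with_proj (competition_graph D))"
proof -
  interpret digraph D by fact
  have "pair_graph (competition_graph D)"
  proof unfold_locales
    show "finite (parcs (competition_graph D))"
      by (rule finite_subset[of _ "verts D \<times> verts D"]) (auto simp: competition_graph_def)
  qed (auto simp: competition_graph_def symmetric_def sym_def)
  then show ?thesis
    by (rule pair_graph.pair_graphD_graph)
qed

definition cycle_graph :: "nat \<Rightarrow> nat pair_pre_digraph" where
  "cycle_graph n =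
     \<lparr> pverts = {..<n},
       parcs = (\<Union>k<n. {(k, Suc k mod n), (Suc k mod n, k)}) \<rparr>"

lemma graph_cycle_graph:
  assumes "n \<ge> 2"
  shows "graph (with_proj (cycle_graph n))"
proof -
  have neq: "Suc k mod n \<noteq> k" if "k < n" for k
    using that assms by (cases "Suc k = n") auto
  have "pair_graph (cycle_graph n)"
    using neq neq[symmetric] assms
    by unfold_locales (auto simp: cycle_graph_def symmetric_def sym_def)
  then show ?thesis
    by (rule pair_graph.pair_graphD_graph)
qed

definition chordal :: "('a,'b) pre_digraph \<Rightarrow> bool" where
  "chordal G \<longleftrightarrow>
     \<not> (\<exists>n\<ge>4. \<exists>H. induced_subgraph H G \<and> digraph_iso (with_proj (cycle_graph n)) H)"

definition ij_digraph :: "nat \<Rightarrow> nat \<Rightarrow> ('a,'b) pre_digraph \<Rightarrow> bool" where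
  "ij_digraph i j D \<longleftrightarrow>
     digraph D \<and> (\<forall>v\<in>verts D. in_degree D v \<le> i \<and> out_degree D v \<le> j)"

definition bar22_digraph :: "('a,'b) pre_digraph \<Rightarrow> bool" where
  "bar22_digraph D \<longleftrightarrow>
     digraph D \<and> (\<forall>v\<in>verts D. in_degree D v \<in> {0, 2} \<and> out_degree D v \<in> {0, 2})"

definition has_subdigraph_iso :: "('a,'b) pre_digraph \<Rightarrow> 'c pair_pre_digraph \<Rightarrow> bool" where
  "has_subdigraph_iso D P \<longleftrightarrow> (\<exists>H. subgraph H D \<and> digraph_iso (with_proj P) H)"

text \<open>The names \<open>U k\<close> and \<open>V k\<close> only serve to make the vertices of the patterns distinct.\<close>

datatype pattern_vertex = U nat | V nat

definition P22 :: "pattern_vertex pair_pre_digraph" where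
  "P22 = \<lparr> pverts = {U 1, U 2, V 1, V 2},
           parcs = {(U 1, V 1), (U 1, V 2), (U 2, V 1), (U 2, V 2)} \<rparr>"

definition triangle_a :: "pattern_vertex pair_pre_digraph" where
  "triangle_a = \<lparr> pverts = {U 1, U 2, U 3, V 1, V 2, V 3},
                  parcs = {(U 1, V 1), (U 1, V 3), (U 2, V 1), (U 2, V 2),
                           (U 3, V 2), (U 3, V 3)} \<rparr>"

definition triangle_b :: "pattern_vertex pair_pre_digraph" where
  "triangle_b = \<lparr> pverts = {U 1, U 2, U 3, V 1},
                  parcs = {(U 1, V 1), (U 2, V 1), (U 3, V 1)} \<rparr>"

definition triangle_c :: "pattern_vertex pair_pre_digraph" where
  "triangle_c = \<lparr> pverts = {U 1, U 2, U 3, V 1, V 3},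
                  parcs = {(U 1, V 1), (U 1, U 2), (U 2, V 1), (U 2, V 3),
                           (U 3, U 2), (U 3, V 3)} \<rparr>"

definition triangle_d :: "pattern_vertex pair_pre_digraph" where
  "triangle_d = \<lparr> pverts = {U 1, U 2, U 3},
                  parcs = {(U 1, U 2), (U 1, U 3), (U 2, U 1), (U 2, U 3),
                           (U 3, U 1), (U 3, U 2)} \<rparr>"

definition triangle_e :: "pattern_vertex pair_pre_digraph" where
  "triangle_e = \<lparr> pverts = {U 1, U 2, V 1, V 2},
                  parcs = {(U 1, U 2), (U 2, U 1), (U 1, V 1), (U 2, V 1),
                           (V 2, U 1), (V 2, U 2)} \<rparr>"

lemma pair_digraph_patterns:
  "pair_digraph P22" "pair_digraph triangle_a" "pair_digraph triangle_b"
  "pair_digraph triangle_c" "pair_digraph triangle_d" "pair_digraph triangle_e"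
  by (unfold_locales;
      auto simp: P22_def triangle_a_def triangle_b_def triangle_c_def triangle_d_def
        triangle_e_def)+

definition irredundant :: "('a,'b) pre_digraph \<Rightarrow> bool" where
  "irredundant D \<longleftrightarrow> \<not> has_subdigraph_iso D P22"

definition induces_triangle :: "('a,'b) pre_digraph \<Rightarrow> bool" where
  "induces_triangle D \<longleftrightarrow>
     (\<exists>P\<in>{triangle_a, triangle_b, triangle_c, triangle_d, triangle_e}. has_subdigraph_iso D P)"

end

(* An induced cycle f 0, ..., f (n - 1) of length at least 4 in the competition graph contains no
   triangle, so the common preys w k of f k and f (k + 1) are distinct and, as outdegrees are at
   most 2, they are the only out-neighbours of the cycle vertices: the arcs leaving the cycle form
   the subdigraph D'.  Conversely, each vertex of D' with an out-neighbour has all its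
   out-neighbours inside D', so these vertices induce in the competition graph of D exactly the
   competition relation of D'.  Irredundancy makes that relation 2-regular, hence a disjoint union
   of induced cycles, and a cycle of length 3 would be a triangle induced by D'. *)

theory Submission
  imports Defs
begin

section \<open>Cyclic successors and cycles in 2-regular relations\<close>

text \<open>Turns equations between cyclic successors into case distinctions for linear arithmetic;
  bounds such as \<open>n \<ge> 4\<close> take effect through these splits.\<close>

lemma Suc_mod_if: "k < n \<Longrightarrow> Suc k mod n = (if Suc k = n then 0 else Suc k)"
  by auto

lemma Suc_mod_surj:
  fixes a n :: nat
  assumes "a < n"
  obtains p where "p < n" "Suc p mod n = a"
proof (cases a)
  case 0
  with assms show ?thesis by (intro that[of "n - 1"]) auto
next
  case (Suc p)
  with assms show ?thesis by (intro that[of p]) auto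
qed

text \<open>A walk in \<open>S\<close> that never turns straight back must repeat a vertex, and its
  first repetition closes a cycle. Each vertex of this cycle already has its two
  \<open>R\<close>-neighbours on it, so there are no chords.\<close>

lemma two_regular_cycle:
  fixes R :: "'a \<Rightarrow> 'a \<Rightarrow> bool"
  assumes fin: "finite S" and ne: "S \<noteq> {}"
    and sym: "\<And>u v. R u v \<Longrightarrow> R v u" and irrefl: "\<And>u. \<not> R u u"
    and closed: "\<And>u v. u \<in> S \<Longrightarrow> R u v \<Longrightarrow> v \<in> S"
    and deg: "\<And>u. u \<in> S \<Longrightarrow> card {v. R u v} = 2"
  obtains n f where "n \<ge> 3" "inj_on f {..<n}" "f ` {..<n} \<subseteq> S"
    "\<And>a b. a < n \<Longrightarrow> b < n \<Longrightarrow> R (f a) (f b) \<longleftrightarrow> b = Suc a mod n \<or> a = Suc b mod n"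
proof -
  have other: "\<exists>w. R v w \<and> w \<noteq> u" if "v \<in> S" for u v
  proof (rule ccontr)
    assume "\<not> ?thesis"
    then have "{w. R v w} \<subseteq> {u}" by auto
    from card_mono[OF _ this] deg[OF that] show False by simp
  qed
  \<comment> \<open>The states of the walk are pairs of consecutive vertices, since forbidding an
    immediate return relates three successive vertices.\<close>
  define P where "P = (\<lambda>(k::nat) (p, c::'a). p \<in> S \<and> R p c)"
  define Q where "Q = (\<lambda>(k::nat) (p, c) (p'::'a, c'::'a). p' = c \<and> c' \<noteq> (p::'a))"
  obtain g where g: "\<And>k. P k (g k)" "\<And>k. Q k (g k) (g (Suc k))"
  proof -
    have "\<exists>x. P 0 x" using ne other by (fastforce simp: P_def)
    moreover have "\<exists>y. P (Suc k) y \<and> Q k x y" if "P k x" for x k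
      using that other[of "snd x" "fst x"] closed[of "fst x" "snd x"]
      by (auto simp: P_def Q_def split: prod.splits)
    ultimately show ?thesis using that dependent_nat_choice[of P Q] by blast
  qed
  define x where "x k = fst (g k)" for k
  have snd_g: "snd (g k) = x (Suc k)" for k
    using g(2)[of k] by (auto simp: Q_def x_def split: prod.splits)
  have xS: "x k \<in> S" for k using g(1)[of k] by (auto simp: P_def x_def split: prod.splits)
  have xR: "R (x k) (x (Suc k))" for k
    using g(1)[of k] unfolding snd_g[symmetric] by (auto simp: P_def x_def split: prod.splits)
  have xQ: "x (Suc (Suc k)) \<noteq> x k" for k
    using g(2)[of k] unfolding snd_g[symmetric] by (auto simp: Q_def x_def split: prod.splits)
  have "\<exists>j. x j \<in> x ` {..<j}"
  proof (rule ccontr)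
    assume "\<not> ?thesis"
    then have "x a \<noteq> x b" if "a < b" for a b using that by (metis imageI lessThan_iff)
    then have "inj x" by (metis injI linorder_neqE_nat)
    moreover have "finite (range x)" using fin xS by (meson finite_subset image_subsetI)
    ultimately show False using finite_imageD infinite_UNIV_nat by blast
  qed
  \<comment> \<open>The first repetition is taken so that all vertices before index \<open>j\<close>
    are pairwise distinct.\<close>
  then obtain j where j: "x j \<in> x ` {..<j}" and jmin: "\<And>m. m < j \<Longrightarrow> x m \<notin> x ` {..<m}"
    using exists_least_iff[of "\<lambda>j. x j \<in> x ` {..<j}"] by auto
  from j obtain i where i: "i < j" "x j = x i" by auto
  have inj: "x a \<noteq> x b" if "a < b" "b < j" for a b
    using jmin[OF that(2)] that(1) by (metis imageI lessThan_iff)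
  define n where "n = j - i"
  define f where "f k = x (i + k)" for k
  \<comment> \<open>Irreflexivity rules out length 1, and the ban on immediate returns rules out
    length 2.\<close>
  have "j \<noteq> Suc i" using xR[of i] i irrefl by metis
  moreover have "j \<noteq> Suc (Suc i)" using xQ[of i] i by metis
  ultimately have n3: "n \<ge> 3" using i by (simp add: n_def)
  have finj: "inj_on f {..<n}"
  proof (rule inj_onI)
    fix a b assume "a \<in> {..<n}" "b \<in> {..<n}" "f a = f b"
    then show "a = b"
      using inj[of "i + a" "i + b"] inj[of "i + b" "i + a"]
      by (cases a b rule: linorder_cases) (auto simp: f_def n_def less_diff_conv add.commute)
  qed
  have fS: "f ` {..<n} \<subseteq> S" using xS by (auto simp: f_def)
  have step: "R (f a) (f (Suc a mod n))" if "a < n" for a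
  proof (cases "Suc a = n")
    case True
    then have "Suc (i + a) = j" using i by (simp add: n_def)
    then show ?thesis using xR[of "i + a"] i True by (simp add: f_def)
  next
    case False
    then show ?thesis using that xR[of "i + a"] by (simp add: f_def)
  qed
  have "R (f a) (f b) \<longleftrightarrow> b = Suc a mod n \<or> a = Suc b mod n" if ab: "a < n" "b < n" for a b
  proof -
    obtain p where p: "p < n" "Suc p mod n = a" using Suc_mod_surj[OF ab(1)] .
    have sa: "Suc a mod n < n" using n3 by simp
    \<comment> \<open>Predecessor and successor differ because \<open>n \<ge> 3\<close>; as two
      \<open>R\<close>-neighbours of \<open>f a\<close> they are all of its neighbours.\<close>
    have "p \<noteq> Suc a mod n" using p n3 by (auto simp: Suc_mod_if split: if_splits)
    then have "f p \<noteq> f (Suc a mod n)" using finj p(1) sa by (metis inj_onD lessThan_iff)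
    then have "card {f p, f (Suc a mod n)} = 2" by simp
    moreover have "{f p, f (Suc a mod n)} \<subseteq> {v. R (f a) v}"
      using step[OF ab(1)] step[OF p(1)] p(2) sym by auto
    moreover have "card {v. R (f a) v} = 2" using deg fS ab(1) by auto
    \<comment> \<open>An infinite set has \<open>card\<close> 0, so cardinality 2 also supplies the
      finiteness that turns the inclusion into an equality.\<close>
    ultimately have "{v. R (f a) v} = {f p, f (Suc a mod n)}"
      by (metis card.infinite card_subset_eq zero_neq_numeral)
    then have "R (f a) (f b) \<longleftrightarrow> f b = f p \<or> f b = f (Suc a mod n)" by auto
    also have "\<dots> \<longleftrightarrow> b = p \<or> b = Suc a mod n"
      using finj p(1) sa ab(2) by (auto dest: inj_onD)
    also have "b = p \<longleftrightarrow> a = Suc b mod n"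
      using p ab by (auto simp: Suc_mod_if split: if_splits)
    finally show ?thesis by blast
  qed
  with n3 finj fS show ?thesis using that by blast
qed

section \<open>Subdigraph patterns as conditions on adjacency\<close>

text \<open>Pattern arcs are pairs of vertices, so any choice of one arc of \<open>D\<close> for
  each pattern arc is injective once the vertex map is. An embedding is therefore determined, up to
  that choice, by its vertex map.\<close>

lemma has_subdigraph_iso_iff:
  assumes "wf_digraph D" "wf_digraph (with_proj P)"
  shows "has_subdigraph_iso D P \<longleftrightarrow>
    (\<exists>f. inj_on f (pverts P) \<and> f ` pverts P \<subseteq> verts D \<and> (\<forall>(x, y)\<in>parcs P. f x \<rightarrow>\<^bsub>D\<^esub> f y))"
proof
  assume "has_subdigraph_iso D P"
  then obtain h where h: "subgraph (app_iso h P) D" "pre_digraph.digraph_isomorphism P h"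
    by (auto simp: has_subdigraph_iso_def digraph_iso_def)
  have "iso_verts h x \<rightarrow>\<^bsub>D\<^esub> iso_verts h y" if "(x, y) \<in> parcs P" for x y
  proof -
    have "iso_arcs h (x, y) \<in> arcs D" using h(1) that by (auto simp: subgraph_def)
    moreover have "tail D (iso_arcs h (x, y)) = iso_verts h x \<and> head D (iso_arcs h (x, y)) = iso_verts h y"
      using h that
      by (auto simp: subgraph_def compatible_def pre_digraph.digraph_isomorphism_def)
    ultimately show ?thesis by (simp add: arcs_ends_conv rev_image_eqI)
  qed
  moreover have "inj_on (iso_verts h) (pverts P)"
    using h(2) by (simp add: pre_digraph.digraph_isomorphism_def)
  moreover have "iso_verts h ` pverts P \<subseteq> verts D"
    using h(1) by (simp add: subgraph_def)
  ultimately show "\<exists>f. inj_on f (pverts P) \<and> f ` pverts P \<subseteq> verts D \<and>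
      (\<forall>(x, y)\<in>parcs P. f x \<rightarrow>\<^bsub>D\<^esub> f y)"
    by blast
next
  assume "\<exists>f. inj_on f (pverts P) \<and> f ` pverts P \<subseteq> verts D \<and> (\<forall>(x, y)\<in>parcs P. f x \<rightarrow>\<^bsub>D\<^esub> f y)"
  then obtain f where f: "inj_on f (pverts P)" "f ` pverts P \<subseteq> verts D"
    "\<forall>(x, y)\<in>parcs P. f x \<rightarrow>\<^bsub>D\<^esub> f y"
    by blast
  have "\<forall>e\<in>parcs P. \<exists>a. a \<in> arcs D \<and> tail D a = f (fst e) \<and> head D a = f (snd e)"
  proof
    fix e assume "e \<in> parcs P"
    then have "f (fst e) \<rightarrow>\<^bsub>D\<^esub> f (snd e)" using f(3) by auto
    then show "\<exists>a. a \<in> arcs D \<and> tail D a = f (fst e) \<and> head D a = f (snd e)"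
      by (auto simp: arcs_ends_conv)
  qed
  from bchoice[OF this] obtain c where
    "\<forall>e\<in>parcs P. c e \<in> arcs D \<and> tail D (c e) = f (fst e) \<and> head D (c e) = f (snd e)" ..
  then have c: "c e \<in> arcs D \<and> tail D (c e) = f (fst e) \<and> head D (c e) = f (snd e)"
    if "e \<in> parcs P" for e using that by (rule bspec)
  \<comment> \<open>The head and tail maps come from \<open>D\<close>, which makes the image
    compatible with \<open>D\<close> as \<open>subgraph\<close> demands.\<close>
  define h where "h = \<lparr>iso_verts = f, iso_arcs = c, iso_head = head D, iso_tail = tail D\<rparr>"
  interpret P: wf_digraph "with_proj P" by fact
  have ends: "fst e \<in> pverts P" "snd e \<in> pverts P" if "e \<in> parcs P" for e
    using P.tail_in_verts[of e] P.head_in_verts[of e] that by auto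
  have "inj_on c (parcs P)"
  proof (rule inj_onI)
    fix e e' assume e: "e \<in> parcs P" "e' \<in> parcs P" and eq: "c e = c e'"
    then have "f (fst e) = f (fst e')" "f (snd e) = f (snd e')"
      using c[OF e(1)] c[OF e(2)] by simp_all
    then show "e = e'"
      using inj_onD[OF f(1)] ends[OF e(1)] ends[OF e(2)] by (simp add: prod_eq_iff)
  qed
  then have iso: "pre_digraph.digraph_isomorphism P h"
    using f(1) c assms(2) by (simp add: pre_digraph.digraph_isomorphism_def h_def)
  have "subgraph (app_iso h P) D"
    using P.wf_digraphI_app_iso[OF iso] f(2) c assms(1)
    by (auto simp: subgraph_def compatible_def h_def)
  then show "has_subdigraph_iso D P"
    using iso by (auto simp: has_subdigraph_iso_def digraph_iso_def)
qed

text \<open>Only \<open>u \<noteq> v\<close> and \<open>x \<noteq> y\<close> have to be required: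
  the other pairs are joined by arcs, and \<open>D\<close> has no loops.\<close>

lemma has_subdigraph_iso_P22_iff:
  assumes "digraph D"
  shows "has_subdigraph_iso D P22 \<longleftrightarrow>
    (\<exists>u v x y. u \<noteq> v \<and> x \<noteq> y \<and> u \<rightarrow>\<^bsub>D\<^esub> x \<and> u \<rightarrow>\<^bsub>D\<^esub> y \<and> v \<rightarrow>\<^bsub>D\<^esub> x \<and> v \<rightarrow>\<^bsub>D\<^esub> y)"
proof -
  interpret digraph D by fact
  interpret P: pair_digraph P22 by (rule pair_digraph_patterns)
  show ?thesis
    unfolding has_subdigraph_iso_iff[OF wf_digraph P.wf_digraph]
  proof
    assume "\<exists>f. inj_on f (pverts P22) \<and> f ` pverts P22 \<subseteq> verts D \<and>
      (\<forall>(x, y)\<in>parcs P22. f x \<rightarrow>\<^bsub>D\<^esub> f y)"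
    then obtain f where "inj_on f (pverts P22)" "\<forall>(x, y)\<in>parcs P22. f x \<rightarrow>\<^bsub>D\<^esub> f y" by blast
    then show "\<exists>u v x y. u \<noteq> v \<and> x \<noteq> y \<and> u \<rightarrow>\<^bsub>D\<^esub> x \<and> u \<rightarrow>\<^bsub>D\<^esub> y \<and> v \<rightarrow>\<^bsub>D\<^esub> x \<and> v \<rightarrow>\<^bsub>D\<^esub> y"
      by (intro exI[of _ "f (U 1)"] exI[of _ "f (U 2)"] exI[of _ "f (V 1)"] exI[of _ "f (V 2)"])
        (auto simp: P22_def)
  next
    assume "\<exists>u v x y. u \<noteq> v \<and> x \<noteq> y \<and> u \<rightarrow>\<^bsub>D\<^esub> x \<and> u \<rightarrow>\<^bsub>D\<^esub> y \<and> v \<rightarrow>\<^bsub>D\<^esub> x \<and> v \<rightarrow>\<^bsub>D\<^esub> y"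
    then obtain u v x y where *: "u \<noteq> v" "x \<noteq> y" "u \<rightarrow>\<^bsub>D\<^esub> x" "u \<rightarrow>\<^bsub>D\<^esub> y" "v \<rightarrow>\<^bsub>D\<^esub> x" "v \<rightarrow>\<^bsub>D\<^esub> y"
      by blast
    then have "u \<noteq> x" "u \<noteq> y" "v \<noteq> x" "v \<noteq> y" using adj_not_same by blast+
    moreover have "{u, v, x, y} \<subseteq> verts D" using * by auto
    ultimately show "\<exists>f. inj_on f (pverts P22) \<and> f ` pverts P22 \<subseteq> verts D \<and>
      (\<forall>(x, y)\<in>parcs P22. f x \<rightarrow>\<^bsub>D\<^esub> f y)"
      using * by (intro exI[of _ "((\<lambda>_. u)(U 2 := v, V 1 := x, V 2 := y))"]) (auto simp: P22_def)
  qed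
qed

text \<open>The five patterns are exactly the ways in which three pairwise competing vertices can
  overlap with their common preys. If two of the preys agree, all three vertices share a prey, which
  is (b). Otherwise the number of preys among the three vertices themselves is 0, 1, 2 or 3, which
  gives (a), (c), (e) or (d).\<close>

lemma induces_triangle_iff:
  assumes "digraph D"
  shows "induces_triangle D \<longleftrightarrow>
    (\<exists>u v w. u \<noteq> v \<and> u \<noteq> w \<and> v \<noteq> w \<and> (\<exists>x. u \<rightarrow>\<^bsub>D\<^esub> x \<and> v \<rightarrow>\<^bsub>D\<^esub> x) \<and>
       (\<exists>x. u \<rightarrow>\<^bsub>D\<^esub> x \<and> w \<rightarrow>\<^bsub>D\<^esub> x) \<and> (\<exists>x. v \<rightarrow>\<^bsub>D\<^esub> x \<and> w \<rightarrow>\<^bsub>D\<^esub> x))" (is "_ \<longleftrightarrow> ?R")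
proof -
  interpret digraph D by fact
  have iff: "has_subdigraph_iso D P \<longleftrightarrow>
      (\<exists>f. inj_on f (pverts P) \<and> f ` pverts P \<subseteq> verts D \<and> (\<forall>(x, y)\<in>parcs P. f x \<rightarrow>\<^bsub>D\<^esub> f y))"
    if "P \<in> {triangle_a, triangle_b, triangle_c, triangle_d, triangle_e}" for P
  proof -
    have "pair_digraph P" using that pair_digraph_patterns by auto
    then interpret P: pair_digraph P .
    show ?thesis by (rule has_subdigraph_iso_iff[OF wf_digraph P.wf_digraph])
  qed
  have emb: "induces_triangle D"
    if "P \<in> {triangle_a, triangle_b, triangle_c, triangle_d, triangle_e}"
      "inj_on f (pverts P)" "f ` pverts P \<subseteq> verts D" "\<forall>(x, y)\<in>parcs P. f x \<rightarrow>\<^bsub>D\<^esub> f y" for P f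
    using that iff[OF that(1)] unfolding induces_triangle_def by blast
  have in_D: "u \<in> verts D" "v \<in> verts D" "u \<noteq> v" if "u \<rightarrow>\<^bsub>D\<^esub> v" for u v
    using that adj_not_same by auto
  note defs = triangle_a_def triangle_b_def triangle_c_def triangle_d_def triangle_e_def
  show ?thesis
  proof
    assume "induces_triangle D"
    then obtain P where P: "P \<in> {triangle_a, triangle_b, triangle_c, triangle_d, triangle_e}"
      "has_subdigraph_iso D P"
      unfolding induces_triangle_def by blast
    then obtain f where f: "inj_on f (pverts P)" "\<forall>(x, y)\<in>parcs P. f x \<rightarrow>\<^bsub>D\<^esub> f y"
      using iff by blast
    consider "P = triangle_a" | "P = triangle_b" | "P = triangle_c" | "P = triangle_d"
      | "P = triangle_e" using P(1) by blast
    then show ?R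
    proof cases
      case 1
      with f show ?thesis
        by (intro exI[of _ "f (U 1)"] exI[of _ "f (U 2)"] exI[of _ "f (U 3)"]) (auto simp: defs)
    next
      case 2
      with f show ?thesis
        by (intro exI[of _ "f (U 1)"] exI[of _ "f (U 2)"] exI[of _ "f (U 3)"]) (auto simp: defs)
    next
      case 3
      with f show ?thesis
        by (intro exI[of _ "f (U 1)"] exI[of _ "f (U 2)"] exI[of _ "f (U 3)"]) (auto simp: defs)
    next
      case 4
      with f show ?thesis
        by (intro exI[of _ "f (U 1)"] exI[of _ "f (U 2)"] exI[of _ "f (U 3)"]) (auto simp: defs)
    next
      \<comment> \<open>In pattern (e) the third competitor is \<open>V 2\<close>: it shares the
        prey \<open>U 2\<close> with \<open>U 1\<close> and the prey \<open>U 1\<close> with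
        \<open>U 2\<close>.\<close>
      case 5
      with f show ?thesis
        by (intro exI[of _ "f (U 1)"] exI[of _ "f (U 2)"] exI[of _ "f (V 2)"]) (auto simp: defs)
    qed
  next
    assume ?R
    then obtain u v w x y z where *: "u \<noteq> v" "u \<noteq> w" "v \<noteq> w"
      "u \<rightarrow>\<^bsub>D\<^esub> x" "v \<rightarrow>\<^bsub>D\<^esub> x" "v \<rightarrow>\<^bsub>D\<^esub> y" "w \<rightarrow>\<^bsub>D\<^esub> y" "u \<rightarrow>\<^bsub>D\<^esub> z" "w \<rightarrow>\<^bsub>D\<^esub> z"
      by blast
    have case_b: "induces_triangle D" if "u \<rightarrow>\<^bsub>D\<^esub> t" "v \<rightarrow>\<^bsub>D\<^esub> t" "w \<rightarrow>\<^bsub>D\<^esub> t" for t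
      using *(1-3) that that[THEN in_D(1)] that[THEN in_D(2)] that[THEN in_D(3)]
      by (intro emb[of triangle_b "(\<lambda>_. u)(U 2 := v, U 3 := w, V 1 := t)"]) (auto simp: defs)
    \<comment> \<open>Here \<open>v'\<close> is itself the prey shared by \<open>u'\<close> and
      \<open>w'\<close>. Fresh names allow the three competitors to be permuted in the cases
      below.\<close>
    have case_c: "induces_triangle D"
      if "u' \<noteq> v'" "u' \<noteq> w'" "v' \<noteq> w'" "x' \<noteq> w'" "z' \<noteq> u'" "x' \<noteq> z'"
        "u' \<rightarrow>\<^bsub>D\<^esub> x'" "v' \<rightarrow>\<^bsub>D\<^esub> x'" "u' \<rightarrow>\<^bsub>D\<^esub> v'" "w' \<rightarrow>\<^bsub>D\<^esub> v'" "v' \<rightarrow>\<^bsub>D\<^esub> z'" "w' \<rightarrow>\<^bsub>D\<^esub> z'" for u' v' w' x' z'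
      using that that(7-12)[THEN in_D(1)] that(7-12)[THEN in_D(2)] that(7-12)[THEN in_D(3)]
      by (intro emb[of triangle_c "(\<lambda>_. u')(U 2 := v', U 3 := w', V 1 := x', V 3 := z')"])
        (auto simp: defs)
    \<comment> \<open>Here \<open>u'\<close> and \<open>v'\<close> prey on each other, and each is
      the prey that the other shares with \<open>w'\<close>.\<close>
    have case_e: "induces_triangle D"
      if "u' \<noteq> v'" "u' \<noteq> w'" "v' \<noteq> w'" "t \<noteq> w'"
        "u' \<rightarrow>\<^bsub>D\<^esub> v'" "v' \<rightarrow>\<^bsub>D\<^esub> u'" "u' \<rightarrow>\<^bsub>D\<^esub> t" "v' \<rightarrow>\<^bsub>D\<^esub> t" "w' \<rightarrow>\<^bsub>D\<^esub> u'" "w' \<rightarrow>\<^bsub>D\<^esub> v'" for u' v' w' t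
      using that that(5-10)[THEN in_D(1)] that(5-10)[THEN in_D(2)] that(5-10)[THEN in_D(3)]
      by (intro emb[of triangle_e "(\<lambda>_. u')(U 2 := v', V 1 := t, V 2 := w')"])
        (auto simp: defs)
    show "induces_triangle D"
    proof (cases "x = y \<or> x = z \<or> y = z")
      case True
      then show ?thesis using case_b * by blast
    next
      case False
      \<comment> \<open>A prey differs from its two predators, so \<open>x\<close> can only coincide
        with \<open>w\<close>, \<open>y\<close> with \<open>u\<close>, and \<open>z\<close> with
        \<open>v\<close>: eight cases.\<close>
      have d: "x \<noteq> u" "x \<noteq> v" "y \<noteq> v" "y \<noteq> w" "z \<noteq> u" "z \<noteq> w"
        using *(4-9)[THEN in_D(3)] by auto
      consider "x \<noteq> w" "y \<noteq> u" "z \<noteq> v" | "x = w" "y \<noteq> u" "z \<noteq> v" | "x \<noteq> w" "y = u" "z \<noteq> v"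
        | "x \<noteq> w" "y \<noteq> u" "z = v" | "x = w" "y = u" "z \<noteq> v" | "x = w" "y \<noteq> u" "z = v"
        | "x \<noteq> w" "y = u" "z = v" | "x = w" "y = u" "z = v" by argo
      then show ?thesis
      proof cases
        case 1
        then show ?thesis
          using False d * *(4-9)[THEN in_D(1)] *(4-9)[THEN in_D(2)]
          by (intro emb[of triangle_a
                "(\<lambda>_. u)(U 2 := v, U 3 := w, V 1 := x, V 2 := y, V 3 := z)"]) (auto simp: defs)
      next
        case 2
        then show ?thesis using False d * by (intro case_c[of u w v z y]) auto
      next
        case 3
        then show ?thesis using False d * by (intro case_c[of v u w x z]) auto
      next
        case 4
        then show ?thesis using False d * by (intro case_c[of u v w x y]) auto
      next
        case 5
        then show ?thesis using False d * by (intro case_e[of u w v z]) auto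
      next
        case 6
        then show ?thesis using False d * by (intro case_e[of v w u y]) auto
      next
        case 7
        then show ?thesis using False d * by (intro case_e[of u v w x]) auto
      next
        case 8
        then show ?thesis
          using d * *(4-9)[THEN in_D(1)]
          by (intro emb[of triangle_d "(\<lambda>_. u)(U 2 := v, U 3 := w)"]) (auto simp: defs)
      qed
    qed
  qed
qed

section \<open>Induced cycles as cyclic enumerations of vertices\<close>

lemma parcs_cycle_graph_iff:
  "(a, b) \<in> parcs (cycle_graph n) \<longleftrightarrow> a < n \<and> b < n \<and> (b = Suc a mod n \<or> a = Suc b mod n)"
  by (auto simp: cycle_graph_def)

text \<open>The arcs of \<open>G\<close> are pairs with the projections as ends, so the arc map of
  an isomorphism from \<open>cycle_graph n\<close> must be \<open>map_prod f f\<close>. What remains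
  of an induced cycle is the enumeration \<open>f\<close>.\<close>

lemma not_chordal_iff:
  assumes "wf_digraph (with_proj G)"
  shows "\<not> chordal (with_proj G) \<longleftrightarrow>
    (\<exists>n\<ge>4. \<exists>f. inj_on f {..<n} \<and> f ` {..<n} \<subseteq> pverts G \<and>
       (\<forall>a<n. \<forall>b<n. (f a, f b) \<in> parcs G \<longleftrightarrow> b = Suc a mod n \<or> a = Suc b mod n))"
proof
  assume "\<not> chordal (with_proj G)"
  then obtain n h where n: "n \<ge> 4" and ind: "induced_subgraph (app_iso h (cycle_graph n)) G"
    and iso: "pre_digraph.digraph_isomorphism (cycle_graph n) h"
    by (auto simp: chordal_def digraph_iso_def)
  define f where "f = iso_verts h"
  have inj: "inj_on f {..<n}" and sub: "f ` {..<n} \<subseteq> pverts G"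
    using iso ind
    by (auto simp: f_def pre_digraph.digraph_isomorphism_def induced_subgraph_def subgraph_def
        cycle_graph_def)
  have "fst (iso_arcs h e) = f (fst e) \<and> snd (iso_arcs h e) = f (snd e)"
    if "e \<in> parcs (cycle_graph n)" for e
    using iso ind that
    by (auto simp: f_def pre_digraph.digraph_isomorphism_def induced_subgraph_def subgraph_def
        compatible_def)
  then have arcs: "iso_arcs h e = map_prod f f e" if "e \<in> parcs (cycle_graph n)" for e
    using that by (simp add: prod_eq_iff)
  have adj: "(f a, f b) \<in> parcs G \<longleftrightarrow> b = Suc a mod n \<or> a = Suc b mod n"
    if "a < n" "b < n" for a b
  proof -
    have "(f a, f b) \<in> parcs G \<longleftrightarrow> (f a, f b) \<in> iso_arcs h ` parcs (cycle_graph n)"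
      using ind that by (auto simp: induced_subgraph_def f_def cycle_graph_def)
    also have "iso_arcs h ` parcs (cycle_graph n) = map_prod f f ` parcs (cycle_graph n)"
      using arcs by (rule image_cong[OF refl])
    also have "(f a, f b) \<in> \<dots> \<longleftrightarrow> (a, b) \<in> parcs (cycle_graph n)"
    proof
      assume "(f a, f b) \<in> map_prod f f ` parcs (cycle_graph n)"
      then obtain c d where cd: "f a = f c" "f b = f d" "(c, d) \<in> parcs (cycle_graph n)" by auto
      then have "c < n" "d < n" by (auto simp: parcs_cycle_graph_iff)
      then have "a = c" "b = d" using cd inj that by (auto dest: inj_onD)
      with cd show "(a, b) \<in> parcs (cycle_graph n)" by simp
    qed force
    finally show ?thesis using that by (simp add: parcs_cycle_graph_iff)
  qed
  show "\<exists>n\<ge>4. \<exists>f. inj_on f {..<n} \<and> f ` {..<n} \<subseteq> pverts G \<and>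
       (\<forall>a<n. \<forall>b<n. (f a, f b) \<in> parcs G \<longleftrightarrow> b = Suc a mod n \<or> a = Suc b mod n)"
    using n inj sub adj by (intro exI[of _ n] conjI exI[of _ f] allI impI) assumption+
next
  assume "\<exists>n\<ge>4. \<exists>f. inj_on f {..<n} \<and> f ` {..<n} \<subseteq> pverts G \<and>
       (\<forall>a<n. \<forall>b<n. (f a, f b) \<in> parcs G \<longleftrightarrow> b = Suc a mod n \<or> a = Suc b mod n)"
  then obtain n f where n: "n \<ge> 4" and inj: "inj_on f {..<n}" and sub: "f ` {..<n} \<subseteq> pverts G"
    and adj: "\<forall>a<n. \<forall>b<n. (f a, f b) \<in> parcs G \<longleftrightarrow> b = Suc a mod n \<or> a = Suc b mod n"
    by (elim exE conjE) (rule that)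
  define h where "h = \<lparr>iso_verts = f, iso_arcs = map_prod f f, iso_head = snd, iso_tail = fst\<rparr>"
  interpret C: graph "with_proj (cycle_graph n)" using n by (intro graph_cycle_graph) simp
  have "inj_on (map_prod f f) (parcs (cycle_graph n))"
    by (rule inj_on_subset[OF map_prod_inj_on[OF inj inj]]) (auto simp: parcs_cycle_graph_iff)
  moreover have "pverts (cycle_graph n) = {..<n}" by (simp add: cycle_graph_def)
  ultimately have iso: "pre_digraph.digraph_isomorphism (cycle_graph n) h"
    using inj C.wf_digraph by (auto simp: pre_digraph.digraph_isomorphism_def h_def)
  have arcs: "map_prod f f ` parcs (cycle_graph n) =
      {e \<in> parcs G. fst e \<in> f ` {..<n} \<and> snd e \<in> f ` {..<n}}"
    using adj by (auto simp: parcs_cycle_graph_iff)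
      (force simp: parcs_cycle_graph_iff)+
  have "induced_subgraph (app_iso h (cycle_graph n)) G"
    using C.wf_digraphI_app_iso[OF iso] sub assms arcs
    by (auto simp: induced_subgraph_def subgraph_def compatible_def h_def cycle_graph_def)
  then show "\<not> chordal (with_proj G)"
    using n iso by (auto simp: chordal_def digraph_iso_def)
qed

section \<open>Degrees and competition in terms of adjacency\<close>

text \<open>Without parallel arcs, \<open>head G\<close> is injective on the arcs leaving
  \<open>u\<close>.\<close>

lemma (in nomulti_digraph) out_degree_eq_card: "out_degree G u = card {v. u \<rightarrow> v}"
proof -
  have "{v. u \<rightarrow> v} = head G ` out_arcs G u"
    by (auto simp: arcs_ends_conv)
  moreover have "inj_on (head G) (out_arcs G u)"
    by (rule inj_onI) (auto intro!: no_multi_arcs simp: arc_to_ends_def)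
  ultimately show ?thesis by (simp add: out_degree_def card_image)
qed

lemma (in nomulti_digraph) in_degree_eq_card: "in_degree G v = card {u. u \<rightarrow> v}"
proof -
  have "{u. u \<rightarrow> v} = tail G ` in_arcs G v"
    by (auto simp: arcs_ends_conv)
  moreover have "inj_on (tail G) (in_arcs G v)"
    by (rule inj_onI) (auto intro!: no_multi_arcs simp: arc_to_ends_def)
  ultimately show ?thesis by (simp add: in_degree_def card_image)
qed

lemma parcs_competition_graph_iff:
  assumes "wf_digraph D"
  shows "(u, v) \<in> parcs (competition_graph D) \<longleftrightarrow> u \<noteq> v \<and> (\<exists>w. u \<rightarrow>\<^bsub>D\<^esub> w \<and> v \<rightarrow>\<^bsub>D\<^esub> w)"
proof -
  interpret wf_digraph D by fact
  have "u \<in> verts D \<and> w \<in> verts D" if "u \<rightarrow>\<^bsub>D\<^esub> w" for u w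
    using that by auto
  then show ?thesis by (fastforce simp: competition_graph_def)
qed

section \<open>From an induced cycle to the subdigraph\<close>

text \<open>With \<open>w k\<close> a common prey of \<open>f k\<close> and its cyclic successor,
  \<open>out_f\<close> and \<open>in_w\<close> determine all arcs leaving the cycle, and degrees and
  irredundancy follow from them. A vertex may be both some \<open>f k\<close> and some
  \<open>w l\<close>, so indegrees and outdegrees are treated separately.\<close>

lemma induced_cycle_subdigraph:
  fixes D :: "('a,'b) pre_digraph"
  assumes "digraph D" and out: "\<And>u. u \<in> verts D \<Longrightarrow> out_degree D u \<le> 2"
    and n: "n \<ge> 4" and inj: "inj_on f {..<n}" and sub: "f ` {..<n} \<subseteq> verts D"
    and adj: "\<And>a b. a < n \<Longrightarrow> b < n \<Longrightarrow>
      (f a, f b) \<in> parcs (competition_graph D) \<longleftrightarrow> b = Suc a mod n \<or> a = Suc b mod n"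
  obtains D' where "subgraph D' D" "bar22_digraph D'" "irredundant D'" "\<not> induces_triangle D'"
    "arcs D' \<noteq> {}"
proof -
  interpret digraph D by fact
  have s: "Suc k mod n < n" for k using n by simp
  have feq: "f a = f b \<longleftrightarrow> a = b" if "a < n" "b < n" for a b
    using inj that by (auto dest: inj_onD)
  have "\<forall>k. \<exists>x. k < n \<longrightarrow> f k \<rightarrow>\<^bsub>D\<^esub> x \<and> f (Suc k mod n) \<rightarrow>\<^bsub>D\<^esub> x"
    using adj[OF _ s] by (auto simp: parcs_competition_graph_iff[OF wf_digraph])
  then obtain w where w: "\<And>k. k < n \<Longrightarrow> f k \<rightarrow>\<^bsub>D\<^esub> w k \<and> f (Suc k mod n) \<rightarrow>\<^bsub>D\<^esub> w k"
    by metis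
  have compete: "b = Suc a mod n \<or> a = Suc b mod n"
    if "a < n" "b < n" "a \<noteq> b" "f a \<rightarrow>\<^bsub>D\<^esub> x" "f b \<rightarrow>\<^bsub>D\<^esub> x" for a b x
    using adj[OF that(1,2)] that feq parcs_competition_graph_iff[OF wf_digraph] by blast
  \<comment> \<open>If \<open>w a\<close> were also the next common prey, \<open>f a\<close> would
    compete with the vertex two steps ahead, a chord when \<open>n \<ge> 4\<close>.\<close>
  have w_next: False if "a < n" "w a = w (Suc a mod n)" for a
  proof -
    let ?c = "Suc (Suc a mod n) mod n"
    have "a \<noteq> ?c" using n that(1) by (auto simp: Suc_mod_if split: if_splits)
    then have "?c = Suc a mod n \<or> a = Suc ?c mod n"
      using compete[OF that(1) s] w[OF that(1)] w[OF s, of a] that(2) by metis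
    then show False using n that(1) by (auto simp: Suc_mod_if split: if_splits)
  qed
  \<comment> \<open>Two distinct known preys exhaust the outdegree bound 2. Indexing by the
    successor avoids naming a cyclic predecessor.\<close>
  have out_f: "{v. f (Suc k mod n) \<rightarrow>\<^bsub>D\<^esub> v} = {w k, w (Suc k mod n)}" if "k < n" for k
  proof -
    have "card {w k, w (Suc k mod n)} = 2" using w_next[OF that] by (auto simp: card_insert_if)
    moreover have "{w k, w (Suc k mod n)} \<subseteq> {v. f (Suc k mod n) \<rightarrow>\<^bsub>D\<^esub> v}"
      using w[OF that] w[OF s, of k] by auto
    moreover have "finite {v. f (Suc k mod n) \<rightarrow>\<^bsub>D\<^esub> v}"
      by (rule finite_subset[OF _ finite_verts]) auto
    moreover have "card {v. f (Suc k mod n) \<rightarrow>\<^bsub>D\<^esub> v} \<le> 2"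
      using out[of "f (Suc k mod n)"] sub s by (auto simp: out_degree_eq_card)
    ultimately show ?thesis using card_seteq by metis
  qed
  \<comment> \<open>A third cycle vertex preying on \<open>w k\<close> would be adjacent to two
    consecutive vertices of the cycle, impossible for \<open>n \<ge> 4\<close>. Vertices off the
    cycle may prey on \<open>w k\<close> as well, hence the restriction on \<open>u\<close>.\<close>
  have in_w: "u \<rightarrow>\<^bsub>D\<^esub> w k \<longleftrightarrow> u = f k \<or> u = f (Suc k mod n)" if k: "k < n" and u_in: "u \<in> f ` {..<n}" for k u
  proof
    assume u: "u \<rightarrow>\<^bsub>D\<^esub> w k"
    obtain b where b: "b < n" "u = f b" using u_in by auto
    have "b = k \<or> b = Suc k mod n"
    proof (rule ccontr)
      assume neq: "\<not> (b = k \<or> b = Suc k mod n)"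
      have "k = Suc b mod n \<or> b = Suc k mod n"
        using compete[OF b(1) k] neq u b(2) w[OF k] by blast
      moreover have "Suc k mod n = Suc b mod n \<or> b = Suc (Suc k mod n) mod n"
        using compete[OF b(1) s] neq u b(2) w[OF k] by blast
      ultimately show False
        using neq n b(1) k by (auto simp: Suc_mod_if split: if_splits)
    qed
    then show "u = f k \<or> u = f (Suc k mod n)" using b(2) by blast
  qed (use w k in auto)
  define S where "S = f ` {..<n}"
  \<comment> \<open>Keeping only the arcs with tail in \<open>S\<close> cuts the indegree of each
    \<open>w k\<close> to two, whatever other predators it has in \<open>D\<close>.\<close>
  define D' where "D' = \<lparr>verts = S \<union> w ` {..<n}, arcs = {e \<in> arcs D. tail D e \<in> S},
    tail = tail D, head = head D\<rparr>"
  have S_next: "\<exists>k<n. u = f (Suc k mod n)" if "u \<in> S" for u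
    using that Suc_mod_surj unfolding S_def by (metis imageE lessThan_iff)
  have dom: "u \<rightarrow>\<^bsub>D'\<^esub> v \<longleftrightarrow> u \<in> S \<and> u \<rightarrow>\<^bsub>D\<^esub> v" for u v
    by (auto simp: arcs_ends_conv D'_def)
  have out_S: "v \<in> w ` {..<n}" if "u \<in> S" "u \<rightarrow>\<^bsub>D\<^esub> v" for u v
    using S_next[OF that(1)] out_f that(2) s by blast
  have wf': "wf_digraph D'"
  proof unfold_locales
    fix e assume "e \<in> arcs D'"
    then have e: "e \<in> arcs D" "tail D e \<in> S" by (auto simp: D'_def)
    then have "tail D e \<rightarrow>\<^bsub>D\<^esub> head D e" by (auto simp: arcs_ends_conv)
    then show "tail D' e \<in> verts D'" "head D' e \<in> verts D'"
      using e out_S by (auto simp: D'_def)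
  qed
  have "v \<in> verts D" if "u \<rightarrow>\<^bsub>D\<^esub> v" for u v using that by auto
  then have "w k \<in> verts D" if "k < n" for k using w[OF that] by blast
  then have sub': "subgraph D' D"
    using wf' wf_digraph sub by (auto simp: subgraph_def compatible_def D'_def S_def)
  interpret D': digraph D'
  proof -
    interpret D': wf_digraph D' by (rule wf')
    show "digraph D'"
      by unfold_locales
        (auto simp: D'_def S_def arc_to_ends_def intro!: no_multi_arcs dest: no_loops)
  qed
  have in_deg: "in_degree D' v \<in> {0, 2}" for v
  proof (cases "v \<in> w ` {..<n}")
    case True
    then obtain k where k: "k < n" "v = w k" by auto
    have "{u. u \<rightarrow>\<^bsub>D'\<^esub> v} = {f k, f (Suc k mod n)}"
      using in_w[OF k(1)] k s by (auto simp: dom S_def)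
    moreover have "k \<noteq> Suc k mod n" using k(1) n by (auto simp: Suc_mod_if)
    then have "f k \<noteq> f (Suc k mod n)" using feq[OF k(1) s] by blast
    ultimately show ?thesis by (simp add: D'.in_degree_eq_card)
  next
    case False
    then have "{u. u \<rightarrow>\<^bsub>D'\<^esub> v} = {}" using out_S by (auto simp: dom)
    then show ?thesis by (simp add: D'.in_degree_eq_card)
  qed
  have out_deg: "out_degree D' u \<in> {0, 2}" for u
  proof (cases "u \<in> S")
    case True
    then obtain k where k: "k < n" "u = f (Suc k mod n)" using S_next by blast
    have "{v. u \<rightarrow>\<^bsub>D'\<^esub> v} = {w k, w (Suc k mod n)}"
      using out_f[OF k(1)] k True by (simp add: dom)
    then show ?thesis using w_next[OF k(1)] by (auto simp: D'.out_degree_eq_card card_insert_if)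
  next
    case False
    then show ?thesis by (simp add: D'.out_degree_eq_card dom)
  qed
  have "bar22_digraph D'"
    using in_deg out_deg D'.digraph_axioms by (auto simp: bar22_digraph_def)
  moreover have "irredundant D'"
    unfolding irredundant_def has_subdigraph_iso_P22_iff[OF D'.digraph_axioms]
  proof (rule notI, elim exE conjE)
    fix u v x y assume "u \<noteq> v" "x \<noteq> y" and
      *: "u \<rightarrow>\<^bsub>D'\<^esub> x" "u \<rightarrow>\<^bsub>D'\<^esub> y" "v \<rightarrow>\<^bsub>D'\<^esub> x" "v \<rightarrow>\<^bsub>D'\<^esub> y"
    then obtain k l where kl: "k < n" "x = w k" "l < n" "y = w l" "k \<noteq> l"
      using out_S dom by (metis imageE lessThan_iff)
    \<comment> \<open>Two shared preys \<open>w k\<close> and \<open>w l\<close> belong to the same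
      pair of consecutive cycle vertices, so \<open>k\<close> and \<open>l\<close> are cyclic
      successors of each other, which would need \<open>n = 2\<close>.\<close>
    have "{u, v} = {f k, f (Suc k mod n)}" "{u, v} = {f l, f (Suc l mod n)}"
      using * \<open>u \<noteq> v\<close> kl in_w[unfolded S_def[symmetric]] by (auto simp: dom)
    then have "{f k, f (Suc k mod n)} = {f l, f (Suc l mod n)}" by simp
    then have "f k = f (Suc l mod n)" "f l = f (Suc k mod n)"
      using kl feq[OF kl(1,3)] by (auto simp: doubleton_eq_iff)
    then have "k = Suc l mod n" "l = Suc k mod n"
      using feq[OF kl(1) s] feq[OF kl(3) s] by auto
    then show False using kl n by (auto simp: Suc_mod_if split: if_splits)
  qed
  moreover have "\<not> induces_triangle D'"
    unfolding induces_triangle_iff[OF D'.digraph_axioms]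
  proof (rule notI, elim exE conjE)
    fix u v x y1 y2 y3 assume neq: "u \<noteq> v" "u \<noteq> x" "v \<noteq> x" and
      *: "u \<rightarrow>\<^bsub>D'\<^esub> y1" "v \<rightarrow>\<^bsub>D'\<^esub> y1" "u \<rightarrow>\<^bsub>D'\<^esub> y2" "x \<rightarrow>\<^bsub>D'\<^esub> y2"
        "v \<rightarrow>\<^bsub>D'\<^esub> y3" "x \<rightarrow>\<^bsub>D'\<^esub> y3"
    then have "u \<in> S" "v \<in> S" "x \<in> S" by (auto simp: dom)
    then obtain a b c where abc: "a < n" "b < n" "c < n" "u = f a" "v = f b" "x = f c"
      by (auto simp: S_def)
    have "a \<noteq> b" "a \<noteq> c" "b \<noteq> c" using abc neq by auto
    \<comment> \<open>Three positions that are pairwise neighbours on the cycle exist only for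
      \<open>n = 3\<close>.\<close>
    then have "b = Suc a mod n \<or> a = Suc b mod n" "c = Suc a mod n \<or> a = Suc c mod n"
      "c = Suc b mod n \<or> b = Suc c mod n"
      using compete[of a b y1] compete[of a c y2] compete[of b c y3] abc *
      unfolding dom by blast+
    then show False using abc(1-3) n by (auto simp: Suc_mod_if split: if_splits)
  qed
  moreover have "arcs D' \<noteq> {}"
  proof -
    have "f 0 \<rightarrow>\<^bsub>D\<^esub> w 0" "f 0 \<in> S" using w[of 0] n by (auto simp: S_def)
    then show ?thesis by (auto simp: D'_def arcs_ends_conv)
  qed
  ultimately show ?thesis using that sub' by blast
qed

section \<open>From the subdigraph to an induced cycle\<close>

text \<open>\<open>two_regular_cycle\<close> is applied to the competition relation \<open>R\<close>
  of \<open>D'\<close> on the set \<open>S\<close> of vertices with an out-neighbour in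
  \<open>D'\<close>; \<open>out_eq\<close> carries the resulting cycle over to the competition graph
  of \<open>D\<close>.\<close>

lemma subdigraph_induced_cycle:
  fixes D :: "('a,'b) pre_digraph"
  assumes "digraph D" and out: "\<And>u. u \<in> verts D \<Longrightarrow> out_degree D u \<le> 2"
    and sub: "subgraph D' D" and bar: "bar22_digraph D'" and irr: "irredundant D'"
    and tri: "\<not> induces_triangle D'" and ne: "arcs D' \<noteq> {}"
  obtains n f where "n \<ge> 4" "inj_on f {..<n}" "f ` {..<n} \<subseteq> verts D"
    "\<And>a b. a < n \<Longrightarrow> b < n \<Longrightarrow>
      (f a, f b) \<in> parcs (competition_graph D) \<longleftrightarrow> b = Suc a mod n \<or> a = Suc b mod n"
proof -
  interpret D: digraph D by fact
  interpret D': digraph D' using bar by (simp add: bar22_digraph_def)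
  define S where "S = {u. \<exists>v. u \<rightarrow>\<^bsub>D'\<^esub> v}"
  define R where "R = (\<lambda>u v. u \<noteq> v \<and> (\<exists>w. u \<rightarrow>\<^bsub>D'\<^esub> w \<and> v \<rightarrow>\<^bsub>D'\<^esub> w))"
  have dom: "u \<rightarrow>\<^bsub>D\<^esub> v" if "u \<rightarrow>\<^bsub>D'\<^esub> v" for u v
    using sub that by (auto simp: arcs_ends_conv subgraph_def compatible_def)
  have in_D': "u \<in> verts D'" "v \<in> verts D'" if "u \<rightarrow>\<^bsub>D'\<^esub> v" for u v
    using that by auto
  have sub_verts: "verts D' \<subseteq> verts D" using sub by (simp add: subgraph_def)
  have fin_out: "finite {v. u \<rightarrow>\<^bsub>D\<^esub> v}" for u
    by (rule finite_subset[OF _ D.finite_verts]) auto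
  \<comment> \<open>Since \<open>card\<close> is 0 on infinite sets, finiteness is what lets an
    existing arc exclude the value 0 among the degrees 0 and 2.\<close>
  have fin_out': "finite {v. u \<rightarrow>\<^bsub>D'\<^esub> v}" "finite {v. v \<rightarrow>\<^bsub>D'\<^esub> u}" for u
    by (rule finite_subset[OF _ D'.finite_verts], auto)+
  have out2: "card {v. u \<rightarrow>\<^bsub>D'\<^esub> v} = 2" if u: "u \<in> S" for u
  proof -
    obtain v where v: "u \<rightarrow>\<^bsub>D'\<^esub> v" using u unfolding S_def by blast
    then have "card {v. u \<rightarrow>\<^bsub>D'\<^esub> v} \<noteq> 0" using fin_out'(1)[of u] by auto
    then show ?thesis
      using bar in_D'(1)[OF v] by (auto simp: bar22_digraph_def D'.out_degree_eq_card)
  qed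
  have in2: "card {v. v \<rightarrow>\<^bsub>D'\<^esub> x} = 2" if "u \<rightarrow>\<^bsub>D'\<^esub> x" for u x
  proof -
    have "card {v. v \<rightarrow>\<^bsub>D'\<^esub> x} \<noteq> 0" using fin_out'(2)[of x] that by auto
    then show ?thesis
      using bar in_D'(2)[OF that] by (auto simp: bar22_digraph_def D'.in_degree_eq_card)
  qed
  \<comment> \<open>Two out-neighbours in \<open>D'\<close> already fill the outdegree bound in
    \<open>D\<close>, so passing from \<open>D'\<close> to \<open>D\<close> adds no competition
    inside \<open>S\<close>.\<close>
  have out_eq: "u \<rightarrow>\<^bsub>D\<^esub> v \<longleftrightarrow> u \<rightarrow>\<^bsub>D'\<^esub> v" if "u \<in> S" for u v
  proof -
    have "{v. u \<rightarrow>\<^bsub>D'\<^esub> v} \<subseteq> {v. u \<rightarrow>\<^bsub>D\<^esub> v}" using dom by auto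
    moreover have "card {v. u \<rightarrow>\<^bsub>D\<^esub> v} \<le> card {v. u \<rightarrow>\<^bsub>D'\<^esub> v}"
      using out[of u] out2[OF that] that in_D'(1) sub_verts
      by (auto simp: S_def D.out_degree_eq_card)
    ultimately have "{v. u \<rightarrow>\<^bsub>D'\<^esub> v} = {v. u \<rightarrow>\<^bsub>D\<^esub> v}" using card_seteq[OF fin_out] by blast
    then show ?thesis by blast
  qed
  have other: "\<exists>a. a \<noteq> u \<and> (\<forall>v. v \<rightarrow>\<^bsub>D'\<^esub> x \<longleftrightarrow> v = u \<or> v = a)" if ux: "u \<rightarrow>\<^bsub>D'\<^esub> x" for u x
  proof -
    obtain b c where bc: "{v. v \<rightarrow>\<^bsub>D'\<^esub> x} = {b, c}" "b \<noteq> c"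
      using in2[OF ux] by (auto simp: card_2_iff)
    then have "v \<rightarrow>\<^bsub>D'\<^esub> x \<longleftrightarrow> v = b \<or> v = c" for v by blast
    with bc(2) ux show ?thesis by metis
  qed
  \<comment> \<open>Each of the two preys of \<open>u\<close> has exactly one further predator.
    Irredundancy makes these two predators distinct, and they are all the competitors of
    \<open>u\<close>.\<close>
  have deg: "card {v. R u v} = 2" if uS: "u \<in> S" for u
  proof -
    obtain x y where xy: "{v. u \<rightarrow>\<^bsub>D'\<^esub> v} = {x, y}" "x \<noteq> y"
      using out2[OF uS] by (auto simp: card_2_iff)
    then have uv: "u \<rightarrow>\<^bsub>D'\<^esub> v \<longleftrightarrow> v = x \<or> v = y" for v by blast
    obtain a where a: "a \<noteq> u" "\<And>v. v \<rightarrow>\<^bsub>D'\<^esub> x \<longleftrightarrow> v = u \<or> v = a"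
      using other[of u x] uv by blast
    obtain b where b: "b \<noteq> u" "\<And>v. v \<rightarrow>\<^bsub>D'\<^esub> y \<longleftrightarrow> v = u \<or> v = b"
      using other[of u y] uv by blast
    have "a \<noteq> b"
      using irr a b xy(2) uv
      unfolding irredundant_def has_subdigraph_iso_P22_iff[OF D'.digraph_axioms] by metis
    moreover have "{v. R u v} = {a, b}"
      using a b uv by (auto simp: R_def)
    ultimately show ?thesis by simp
  qed
  have "finite S"
    by (rule finite_subset[OF _ D'.finite_verts]) (auto simp: S_def)
  moreover have "S \<noteq> {}" using ne by (auto simp: S_def arcs_ends_conv)
  ultimately obtain n f where n: "n \<ge> 3" and f: "inj_on f {..<n}" "f ` {..<n} \<subseteq> S"
    and adj: "\<And>a b. a < n \<Longrightarrow> b < n \<Longrightarrow> R (f a) (f b) \<longleftrightarrow> b = Suc a mod n \<or> a = Suc b mod n"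
  proof (rule two_regular_cycle[of S R])
    show "R v u" if "R u v" for u v using that by (auto simp: R_def)
    show "\<not> R u u" for u by (simp add: R_def)
    show "v \<in> S" if "u \<in> S" "R u v" for u v using that by (auto simp: R_def S_def)
  qed (use deg in auto)
  have "n \<noteq> 3"
  proof
    assume "n = 3"
    then have "R (f 0) (f 1)" "R (f 0) (f 2)" "R (f 1) (f 2)"
      using adj[of 0 1] adj[of 0 2] adj[of 1 2] by auto
    then show False
      using tri unfolding induces_triangle_iff[OF D'.digraph_axioms] R_def by metis
  qed
  with n have "n \<ge> 4" by simp
  moreover have "f ` {..<n} \<subseteq> verts D"
    using f(2) in_D'(1) sub_verts by (fastforce simp: S_def)
  moreover have "(f a, f b) \<in> parcs (competition_graph D) \<longleftrightarrow> b = Suc a mod n \<or> a = Suc b mod n"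
    if "a < n" "b < n" for a b
  proof -
    have "f a \<in> S" "f b \<in> S" using f(2) that by auto
    then have "(f a, f b) \<in> parcs (competition_graph D) \<longleftrightarrow> R (f a) (f b)"
      by (simp add: parcs_competition_graph_iff[OF D.wf_digraph] R_def out_eq)
    then show ?thesis using adj[OF that] by simp
  qed
  ultimately show ?thesis using that f(1) by blast
qed

theorem theorem2p11:
  fixes i :: nat and D :: "('a,'b) pre_digraph"
  assumes "i > 0" and "ij_digraph i 2 D"
  shows "chordal (with_proj (competition_graph D)) \<longleftrightarrow>
    \<not> (\<exists>D'. subgraph D' D \<and> bar22_digraph D' \<and>
          irredundant D' \<and> \<not> induces_triangle D' \<and> arcs D' \<noteq> {})"
proof -
  have D: "digraph D" and out: "\<And>u. u \<in> verts D \<Longrightarrow> out_degree D u \<le> 2"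
    using assms(2) by (auto simp: ij_digraph_def)
  interpret G: graph "with_proj (competition_graph D)"
    by (rule graph_competition_graph[OF D])
  have verts: "pverts (competition_graph D) = verts D"
    by (simp add: competition_graph_def)
  \<comment> \<open>The equivalence is proved in negated form, where both sides are existence
    statements that the two constructions supply.\<close>
  have "\<not> chordal (with_proj (competition_graph D)) \<longleftrightarrow>
    (\<exists>D'. subgraph D' D \<and> bar22_digraph D' \<and>
          irredundant D' \<and> \<not> induces_triangle D' \<and> arcs D' \<noteq> {})"
    unfolding not_chordal_iff[OF G.wf_digraph] verts
  proof (intro iffI; elim exE conjE)
    fix n f assume f: "n \<ge> 4" "inj_on f {..<n}" "f ` {..<n} \<subseteq> verts D" and
      "\<forall>a<n. \<forall>b<n. (f a, f b) \<in> parcs (competition_graph D) \<longleftrightarrow>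
        b = Suc a mod n \<or> a = Suc b mod n"
    then have adj: "(f a, f b) \<in> parcs (competition_graph D) \<longleftrightarrow> b = Suc a mod n \<or> a = Suc b mod n"
      if "a < n" "b < n" for a b
      using that by (elim allE[of _ a] allE[of _ b] impE)
    show "\<exists>D'. subgraph D' D \<and> bar22_digraph D' \<and>
          irredundant D' \<and> \<not> induces_triangle D' \<and> arcs D' \<noteq> {}"
      by (rule induced_cycle_subdigraph[OF D out f adj]) blast+
  next
    fix D' assume D': "subgraph D' D" "bar22_digraph D'" "irredundant D'" "\<not> induces_triangle D'"
      "arcs D' \<noteq> {}"
    show "\<exists>n\<ge>4. \<exists>f. inj_on f {..<n} \<and> f ` {..<n} \<subseteq> verts D \<and>
        (\<forall>a<n. \<forall>b<n. (f a, f b) \<in> parcs (competition_graph D) \<longleftrightarrow>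
          b = Suc a mod n \<or> a = Suc b mod n)" (is ?cycle)
    proof (rule subdigraph_induced_cycle[OF D out D'])
      fix n f assume "n \<ge> 4" "inj_on f {..<n}" "f ` {..<n} \<subseteq> verts D" and
        "\<And>a b. a < n \<Longrightarrow> b < n \<Longrightarrow> (f a, f b) \<in> parcs (competition_graph D) \<longleftrightarrow>
          b = Suc a mod n \<or> a = Suc b mod n"
      then show ?cycle
        by (intro exI[of _ n] conjI exI[of _ f] allI impI) assumption+
    qed
  qed
  then show ?thesis by blast
qed

end
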